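(* Let $A\in\mathbb{R}^{m\times n}$ and let $C\subseteq\mathbb{R}^n$, $D\subseteq\mathbb{R}^m$ be nonempty closed sets (possibly nonconvex). Let $x^*\in C\cap A^{-1}D$ and suppose that the pair of sets $\{C,A^{-1}D\}$ has a linearly regular intersection with respect to $A$ at $x^*$, i.e., the following implication holds: if $A^Tw^*+v^*=0$ for some $w^*\in N_D(Ax^* )$ and $v^*\in N_C(x^* )$, then $w^*=0$ and $v^*=0$. Then the function $F(x)=\frac12 d^2(Ax,D)+\delta_C(x)$ has the KL property with exponent $\frac12$ at $x^*$.
   Context: Notation. $\|\cdot\|$ is the Euclidean norm; $d(x,S)=\inf_{u\in S}\|x-u\|$; $A^{-1}D=\{x\in\mathbb{R}^n: Ax\in D\}$; $\delta_C$ is the indicator function ($0$ on $C$, $+\infty$ elsewhere). For a proper lower semicontinuous $f:\mathbb{R}^n\to(-\infty,\infty]$ and $\bar x\in\mathrm{dom} f$, the regular subdifferential is $\hat\partial f(\bar x)=\{v:\liminf_{x\to\bar x,x\ne\bar x}\frac{f(x)-f(\bar x)-\langle v,x-\bar x\rangle}{\|x-\bar x\|}\ge 0\}$ and the (limiting) subdifferential is $\partial f(\bar x)=\{v:\exists\, x^t\to\bar x \text{ with } f(x^t)\to f(\bar x),\ v^t\to v,\ v^t\in\hat\partial f(x^t)\ \forall t\}$; both are empty outside $\mathrm{dom} f$; $\mathrm{dom}\,\partial f=\{x:\partial f(x)\neq\emptyset\}$. The limiting normal cone of a closed set $S$ at $x\in S$ is $N_S(x)=\partial\delta_S(x)$.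 KL exponent. For $\theta\in[0,1)$, a proper closed (lower semicontinuous) function $f$ satisfies the KL property at $\bar x\in\mathrm{dom}\,\partial f$ with exponent $\theta$ if there exist $c,\epsilon>0$ and $s\in(0,+\infty]$ such that $d(0,\partial f(x))\ge c\,(f(x)-f(\bar x))^{\theta}$ whenever $\|x-\bar x\|\le\epsilon$ and $0<f(x)-f(\bar x)<s$ (with $d(0,\emptyset)=+\infty$). *)

theory Defs
  imports "HOL-Analysis.Analysis"
begin

definition eff_dom :: "('a \<Rightarrow> ereal) \<Rightarrow> 'a set" where
  "eff_dom f = {x. f x < \<infinity>}"

definition proper_fun :: "('a \<Rightarrow> ereal) \<Rightarrow> bool" where
  "proper_fun f \<longleftrightarrow> (\<forall>x. f x \<noteq> -\<infinity>) \<and> eff_dom f \<noteq> {}"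

definition lsc :: "('a::topological_space \<Rightarrow> ereal) \<Rightarrow> bool" where
  "lsc f \<longleftrightarrow> (\<forall>x. f x \<le> Liminf (at x) f)"

definition delta :: "'a set \<Rightarrow> 'a \<Rightarrow> ereal" where
  "delta S x = (if x \<in> S then 0 else \<infinity>)"

text \<open>Extended-valued distance, so that the distance to the empty set is \<open>\<infinity>\<close>
  (the library's \<open>infdist\<close> is \<open>0\<close> there).\<close>

definition ext_dist :: "'a::metric_space \<Rightarrow> 'a set \<Rightarrow> ereal" where
  "ext_dist x S = (INF u\<in>S. ereal (dist x u))"

text \<open>The filter \<open>at x\<close> is punctured, so the quotient is never considered at \<open>y = x\<close>.\<close>

definition regular_subdiff :: "('a::euclidean_space \<Rightarrow> ereal) \<Rightarrow> 'a \<Rightarrow> 'a set" where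
  "regular_subdiff f x = {v. x \<in> eff_dom f \<and>
     0 \<le> Liminf (at x) (\<lambda>y. (f y - f x - ereal (v \<bullet> (y - x))) / ereal (norm (y - x)))}"

definition subdiff :: "('a::euclidean_space \<Rightarrow> ereal) \<Rightarrow> 'a \<Rightarrow> 'a set" where
  "subdiff f x = {v. x \<in> eff_dom f \<and>
     (\<exists>xs vs. xs \<longlonglongrightarrow> x \<and> (\<lambda>t. f (xs t)) \<longlonglongrightarrow> f x \<and> vs \<longlonglongrightarrow> v \<and>
        (\<forall>t::nat. vs t \<in> regular_subdiff f (xs t)))}"

definition dom_subdiff :: "('a::euclidean_space \<Rightarrow> ereal) \<Rightarrow> 'a set" where
  "dom_subdiff f = {x. subdiff f x \<noteq> {}}"

definition normal_cone :: "'a::euclidean_space set \<Rightarrow> 'a \<Rightarrow> 'a set" where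
  "normal_cone S x = subdiff (delta S) x"

text \<open>The standing requirements on \<open>f\<close>, \<open>x\<close> and \<open>\<theta>\<close> are part of the property.
  The bounds \<open>0 < f y - f x < s\<close> make the difference a finite positive number,
  so \<open>real_of_ereal\<close> loses nothing, also when \<open>s = \<infinity>\<close>.\<close>

definition KL_exponent :: "('a::euclidean_space \<Rightarrow> ereal) \<Rightarrow> 'a \<Rightarrow> real \<Rightarrow> bool" where
  "KL_exponent f x \<theta> \<longleftrightarrow>
     proper_fun f \<and> lsc f \<and> x \<in> dom_subdiff f \<and> 0 \<le> \<theta> \<and> \<theta> < 1 \<and>
     (\<exists>c>0. \<exists>\<epsilon>>0. \<exists>s::ereal. 0 < s \<and>
        (\<forall>y. norm (y - x) \<le> \<epsilon> \<and> 0 < f y - f x \<and> f y - f x < s \<longrightarrow>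
           ereal (c * real_of_ereal (f y - f x) powr \<theta>) \<le> ext_dist 0 (subdiff f y)))"

definition linearly_regular ::
    "real^'n^'m \<Rightarrow> (real^'n) set \<Rightarrow> (real^'m) set \<Rightarrow> real^'n \<Rightarrow> bool" where
  "linearly_regular A C D x \<longleftrightarrow>
     (\<forall>w \<in> normal_cone D (A *v x). \<forall>v \<in> normal_cone C x.
        transpose A *v w + v = 0 \<longrightarrow> w = 0 \<and> v = 0)"

end

theory Submission
  imports Defs
begin

text \<open>
  Write \<open>F x = 1/2 * d(A x, D)^2 + delta C x\<close>.  Since \<open>F x\<^sub>0 = 0\<close>, the inequality of the KL property
  with exponent \<open>1/2\<close> says that every subgradient \<open>v\<close> of \<open>F\<close> at a nearby \<open>y \<in> C\<close> with \<open>A y \<notin> D\<close>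
  satisfies \<open>norm v \<ge> c * d(A y, D)\<close>, up to the factor \<open>sqrt 2\<close> in the constant.

  Let \<open>p\<close> be a nearest point of \<open>D\<close> to \<open>A y\<close>.
  The smooth function \<open>z \<mapsto> 1/2 * norm (A z - p)^2\<close> majorizes \<open>1/2 * d(A z, D)^2\<close> and agrees with it at
  \<open>y\<close>, so a regular subgradient \<open>v\<close> of \<open>F\<close> at \<open>y\<close> is also one of the majorant restricted to \<open>C\<close>; hence
  \<open>v - A\<^sup>T (A y - p)\<close> is a regular normal of \<open>C\<close> at \<open>y\<close> (\<open>regular_normal_of_dist_sq_subgradient\<close>).
  Moreover \<open>A y - p\<close> is a regular normal of \<open>D\<close> at \<open>p\<close> (\<open>regular_normal_of_nearest_point\<close>).

  If the bound failed for every \<open>c\<close> near \<open>x\<^sub>0\<close>, there would be \<open>y\<^sub>k \<rightarrow> x\<^sub>0\<close> and \<open>v\<^sub>k\<close> with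
  \<open>norm v\<^sub>k / d(A y\<^sub>k, D) \<rightarrow> 0\<close>.  Dividing both normals by \<open>d(A y\<^sub>k, D)\<close> and passing to a subsequence
  gives a unit vector \<open>w\<close> in the limiting normal cone of \<open>D\<close> at \<open>A x\<^sub>0\<close> such that \<open>- A\<^sup>T w\<close> lies in
  that of \<open>C\<close> at \<open>x\<^sub>0\<close>, which linear regularity forbids (\<open>regular_subgradient_lower_bound\<close>).
  The bound passes from regular to limiting subgradients because \<open>d(A y, D)\<close> is continuous in \<open>y\<close>.
\<close>

section \<open>Regular subgradients of a finite function restricted to a set\<close>

text \<open>Every function below is a finite function plus an indicator.  Off the set the difference
  quotient is \<open>\<infinity>\<close>, so the extended-real lower limit reduces to a real inequality along the set.
  Taking \<open>g = 0\<close> covers normals.\<close>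

lemma regular_subdiff_add_delta_iff:
  fixes g :: "'a::euclidean_space \<Rightarrow> real"
  shows "v \<in> regular_subdiff (\<lambda>x. ereal (g x) + delta S x) x \<longleftrightarrow>
    x \<in> S \<and> (\<forall>e>0. \<forall>\<^sub>F y in at x within S. v \<bullet> (y - x) \<le> g y - g x + e * norm (y - x))"
    (is "?L \<longleftrightarrow> ?R")
proof (cases "x \<in> S")
  case False
  then show ?thesis
    by (simp add: regular_subdiff_def eff_dom_def delta_def)
next
  case True
  define f where "f = (\<lambda>x. ereal (g x) + delta S x)"
  define Q where "Q = (\<lambda>y. (f y - f x - ereal (v \<bullet> (y - x))) / ereal (norm (y - x)))"
  have fx: "f x = ereal (g x)"
    using True by (simp add: f_def delta_def)
  have Q_in: "Q y = ereal ((g y - g x - v \<bullet> (y - x)) / norm (y - x))" if "y \<in> S" "y \<noteq> x" for y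
    using that by (simp add: Q_def fx) (simp add: f_def delta_def)
  have Q_out: "Q y = \<infinity>" if "y \<notin> S" "y \<noteq> x" for y
    using that by (simp add: Q_def fx) (simp add: f_def delta_def)
  have key: "ereal (- e) \<le> Q y \<longleftrightarrow> (y \<in> S \<longrightarrow> v \<bullet> (y - x) \<le> g y - g x + e * norm (y - x))"
    if "y \<noteq> x" for y e
    using that by (cases "y \<in> S") (auto simp: Q_in Q_out field_simps)
  have within: "(\<forall>\<^sub>F y in at x. ereal (- e) \<le> Q y) \<longleftrightarrow>
      (\<forall>\<^sub>F y in at x within S. v \<bullet> (y - x) \<le> g y - g x + e * norm (y - x))" for e
    unfolding eventually_at_filter using key
    by (intro iffI; elim eventually_mono; blast)
  have "?L \<longleftrightarrow> 0 \<le> Liminf (at x) Q"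
    using True fx by (simp add: regular_subdiff_def eff_dom_def Q_def f_def delta_def)
  also have "\<dots> \<longleftrightarrow> (\<forall>e>0. \<forall>\<^sub>F y in at x. ereal (- e) \<le> Q y)"
  proof
    assume *: "0 \<le> Liminf (at x) Q"
    show "\<forall>e>0. \<forall>\<^sub>F y in at x. ereal (- e) \<le> Q y"
    proof (intro allI impI)
      fix e :: real assume "e > 0"
      then have "ereal (- e) < 0" by simp
      with * have "\<forall>\<^sub>F y in at x. ereal (- e) < Q y"
        by (auto simp: le_Liminf_iff)
      then show "\<forall>\<^sub>F y in at x. ereal (- e) \<le> Q y"
        by (rule eventually_mono) simp
    qed
  next
    assume *: "\<forall>e>0. \<forall>\<^sub>F y in at x. ereal (- e) \<le> Q y"
    show "0 \<le> Liminf (at x) Q"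
      unfolding le_Liminf_iff
    proof (intro allI impI)
      fix a :: ereal assume "a < 0"
      then obtain r where r: "a < ereal r" "ereal r < 0"
        using ereal_dense2 by blast
      then have "\<forall>\<^sub>F y in at x. ereal (- (- r)) \<le> Q y"
        using * by (metis ereal_less(1) neg_0_less_iff_less)
      then show "\<forall>\<^sub>F y in at x. a < Q y"
        by (rule eventually_mono) (use r in \<open>auto intro: less_le_trans\<close>)
    qed
  qed
  also have "\<dots> \<longleftrightarrow> ?R"
    using True by (simp add: within)
  finally show ?thesis .
qed

lemma regular_subdiff_delta_iff:
  "v \<in> regular_subdiff (delta S) x \<longleftrightarrow>
    x \<in> S \<and> (\<forall>e>0. \<forall>\<^sub>F y in at x within S. v \<bullet> (y - x) \<le> e * norm (y - x))"
proof -
  have "delta S = (\<lambda>x. ereal 0 + delta S x)"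
    by (simp flip: zero_ereal_def)
  then show ?thesis
    using regular_subdiff_add_delta_iff[of v "\<lambda>_. 0" S x] by simp
qed

lemma lsc_add_delta:
  fixes g :: "'a::t2_space \<Rightarrow> real"
  assumes "continuous_on UNIV g" and "closed S"
  shows "lsc (\<lambda>x. ereal (g x) + delta S x)"
  unfolding lsc_def le_Liminf_iff
proof (intro allI impI)
  fix x and a :: ereal
  assume a: "a < ereal (g x) + delta S x"
  show "\<forall>\<^sub>F z in at x. a < ereal (g z) + delta S z"
  proof (cases "x \<in> S")
    case True
    have "(g \<longlongrightarrow> g x) (at x)"
      using assms(1) by (simp add: continuous_on_eq_continuous_at isCont_def)
    then have "((\<lambda>z. ereal (g z)) \<longlongrightarrow> ereal (g x)) (at x)"
      by simp
    then have "\<forall>\<^sub>F z in at x. a < ereal (g z)"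
      using a True by (intro order_tendstoD(1)) (auto simp: delta_def)
    then show ?thesis
      by (rule eventually_mono) (use a in \<open>auto simp: delta_def\<close>)
  next
    case False
    then have "\<forall>\<^sub>F z in at x. z \<in> - S"
      using assms(2) by (intro eventually_at_in_open') auto
    then show ?thesis
      by (rule eventually_mono) (use a False in \<open>auto simp: delta_def\<close>)
  qed
qed

section \<open>Normals\<close>

lemma regular_normal_scale:
  assumes "v \<in> regular_subdiff (delta S) x" and "0 \<le> r"
  shows "r *\<^sub>R v \<in> regular_subdiff (delta S) x"
  unfolding regular_subdiff_delta_iff
proof (intro conjI allI impI)
  show "x \<in> S"
    using assms(1) by (simp add: regular_subdiff_delta_iff)
  fix e :: real assume e: "e > 0"
  \<comment> \<open>The denominator \<open>r + 1\<close> instead of \<open>r\<close> avoids a separate case \<open>r = 0\<close>.\<close>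
  have "\<forall>\<^sub>F y in at x within S. v \<bullet> (y - x) \<le> (e / (r + 1)) * norm (y - x)"
  proof -
    have "e / (r + 1) > 0"
      using assms(2) e by simp
    then show ?thesis
      using assms(1) unfolding regular_subdiff_delta_iff by blast
  qed
  then show "\<forall>\<^sub>F y in at x within S. (r *\<^sub>R v) \<bullet> (y - x) \<le> e * norm (y - x)"
  proof (rule eventually_mono)
    fix y assume "v \<bullet> (y - x) \<le> (e / (r + 1)) * norm (y - x)"
    then have "r * (v \<bullet> (y - x)) \<le> r * ((e / (r + 1)) * norm (y - x))"
      using assms(2) by (intro mult_left_mono)
    also have "\<dots> = (r * e / (r + 1)) * norm (y - x)"
      by simp
    also have "\<dots> \<le> e * norm (y - x)"
      using assms(2) e by (intro mult_right_mono) (auto simp: field_simps)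
    finally show "(r *\<^sub>R v) \<bullet> (y - x) \<le> e * norm (y - x)"
      by simp
  qed
qed

lemma eventually_quadratic_le_linear:
  fixes x :: "'a::real_normed_vector"
  assumes "e > 0"
  shows "\<forall>\<^sub>F y in at x within S. K * (norm (y - x))\<^sup>2 \<le> e * norm (y - x)"
proof -
  have "((\<lambda>y. K * norm (y - x)) \<longlongrightarrow> K * norm (x - x)) (at x within S)"
    by (intro tendsto_intros)
  then have "\<forall>\<^sub>F y in at x within S. K * norm (y - x) < e"
    using assms by (intro order_tendstoD(2)) auto
  then show ?thesis
  proof (rule eventually_mono)
    fix y assume "K * norm (y - x) < e"
    then have "K * norm (y - x) * norm (y - x) \<le> e * norm (y - x)"
      by (intro mult_right_mono) auto
    then show "K * (norm (y - x))\<^sup>2 \<le> e * norm (y - x)"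
      by (simp add: power2_eq_square mult.assoc)
  qed
qed

text \<open>Expanding \<open>norm (z - q)^2 \<ge> norm (z - p)^2\<close> shows that \<open>z - p\<close> is a proximal normal:
  its inner product with \<open>q - p\<close> is at most quadratic in \<open>q - p\<close>.\<close>

lemma regular_normal_of_nearest_point:
  fixes z :: "'a::euclidean_space"
  assumes "p \<in> S" and "infdist z S = dist z p"
  shows "z - p \<in> regular_subdiff (delta S) p"
  unfolding regular_subdiff_delta_iff
proof (intro conjI allI impI)
  fix e :: real assume "e > 0"
  then have "\<forall>\<^sub>F q in at p within S. (1/2) * (norm (q - p))\<^sup>2 \<le> e * norm (q - p)"
    by (rule eventually_quadratic_le_linear)
  moreover have "\<forall>\<^sub>F q in at p within S. q \<in> S"
    by (simp add: eventually_at_filter)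
  ultimately show "\<forall>\<^sub>F q in at p within S. (z - p) \<bullet> (q - p) \<le> e * norm (q - p)"
  proof eventually_elim
    case (elim q)
    have "norm (z - p) \<le> norm (z - q)"
      using infdist_le[OF elim(2), of z] assms(2) by (simp add: dist_norm)
    then have "(norm (z - p))\<^sup>2 \<le> (norm ((z - p) - (q - p)))\<^sup>2"
      by simp
    also have "\<dots> = (norm (z - p))\<^sup>2 - 2 * ((z - p) \<bullet> (q - p)) + (norm (q - p))\<^sup>2"
      unfolding power2_norm_eq_inner by (simp add: inner_diff inner_commute)
    finally show ?case
      using elim(1) by simp
  qed
qed (use assms in simp)

lemma normal_cone_limit:
  assumes "\<And>k. us k \<in> regular_subdiff (delta S) (xs k)"
    and "xs \<longlonglongrightarrow> x" and "us \<longlonglongrightarrow> u" and "x \<in> S"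
  shows "u \<in> normal_cone S x"
proof -
  have "\<And>k. xs k \<in> S"
    using assms(1) by (simp add: regular_subdiff_delta_iff)
  then have "(\<lambda>k. delta S (xs k)) \<longlonglongrightarrow> delta S x"
    using assms(4) by (simp add: delta_def)
  then show ?thesis
    using assms by (auto simp: normal_cone_def subdiff_def eff_dom_def delta_def)
qed

section \<open>Subgradients of the restricted squared distance\<close>

text \<open>The function \<open>z \<mapsto> 1/2 * norm (A z - p)^2\<close> majorizes the half squared distance and touches it
  at \<open>y\<close>; the gradient of the majorant at \<open>y\<close> is \<open>A\<^sup>T (A y - p)\<close>, with the quadratic
  remainder \<open>1/2 * norm (A (z - y))^2\<close>.\<close>

lemma regular_normal_of_dist_sq_subgradient:
  fixes A :: "real^'n^'m"
  assumes v: "v \<in> regular_subdiff (\<lambda>x. ereal (1/2 * (infdist (A *v x) D)\<^sup>2) + delta C x) y"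
    and p: "p \<in> D" "infdist (A *v y) D = dist (A *v y) p"
  shows "v - transpose A *v (A *v y - p) \<in> regular_subdiff (delta C) y"
  unfolding regular_subdiff_delta_iff
proof (intro conjI allI impI)
  show "y \<in> C"
    using v by (simp only: regular_subdiff_add_delta_iff)
  fix e :: real assume "e > 0"
  then have e: "e / 2 > 0" by simp
  obtain K where K: "\<And>h. norm (A *v h) \<le> norm h * K"
    using bounded_linear.bounded[OF matrix_vector_mul_bounded_linear[of A]] by blast
  have "\<forall>\<^sub>F z in at y within C. v \<bullet> (z - y) \<le>
      1/2 * (infdist (A *v z) D)\<^sup>2 - 1/2 * (infdist (A *v y) D)\<^sup>2 + e/2 * norm (z - y)"
    using v e unfolding regular_subdiff_add_delta_iff by blast
  moreover have "\<forall>\<^sub>F z in at y within C. (K\<^sup>2 / 2) * (norm (z - y))\<^sup>2 \<le> e/2 * norm (z - y)"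
    using e by (rule eventually_quadratic_le_linear)
  ultimately show "\<forall>\<^sub>F z in at y within C.
      (v - transpose A *v (A *v y - p)) \<bullet> (z - y) \<le> e * norm (z - y)"
  proof eventually_elim
    case (elim z)
    define h where "h = A *v (z - y)"
    define w where "w = A *v y - p"
    have "infdist (A *v z) D \<le> norm (w + h)"
      using infdist_le[OF p(1), of "A *v z"]
      by (simp add: dist_norm w_def h_def matrix_vector_mult_diff_distrib)
    then have "(infdist (A *v z) D)\<^sup>2 \<le> (norm (w + h))\<^sup>2"
      by (intro power_mono infdist_nonneg)
    also have "\<dots> = (norm w)\<^sup>2 + 2 * (w \<bullet> h) + (norm h)\<^sup>2"
      unfolding power2_norm_eq_inner by (simp add: inner_add inner_commute)
    finally have 1: "(infdist (A *v z) D)\<^sup>2 \<le> (norm w)\<^sup>2 + 2 * (w \<bullet> h) + (norm h)\<^sup>2" .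
    have 2: "(infdist (A *v y) D)\<^sup>2 = (norm w)\<^sup>2"
      by (simp add: p(2) dist_norm w_def)
    have "(norm h)\<^sup>2 \<le> (norm (z - y) * K)\<^sup>2"
      unfolding h_def by (intro power_mono K norm_ge_zero)
    then have 3: "(norm h)\<^sup>2 \<le> K\<^sup>2 * (norm (z - y))\<^sup>2"
      by (simp add: power_mult_distrib mult.commute)
    have 4: "(transpose A *v w) \<bullet> (z - y) = w \<bullet> h"
      by (simp add: h_def dot_lmul_matrix)
    show ?case
      using 1 2 3 4 elim by (simp add: inner_diff_left flip: w_def)
  qed
qed

text \<open>Compactness argument.  One constant serves as both radius and factor, so that the failure for
  \<open>c = 1 / (k + 1)\<close> produces sequences directly.  The normals of \<open>D\<close> normalize to unit vectors, so
  they cannot vanish in the limit, while the rescaled subgradients do; what remains of the normals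
  of \<open>C\<close> is \<open>- A\<^sup>T w\<close>.\<close>

lemma regular_subgradient_lower_bound:
  fixes A :: "real^'n^'m"
  assumes D: "closed D" and x0: "x\<^sub>0 \<in> C" "A *v x\<^sub>0 \<in> D"
    and reg: "linearly_regular A C D x\<^sub>0"
  obtains c where "c > 0"
    "\<And>y v. norm (y - x\<^sub>0) < c \<Longrightarrow>
      v \<in> regular_subdiff (\<lambda>x. ereal (1/2 * (infdist (A *v x) D)\<^sup>2) + delta C x) y \<Longrightarrow>
      c * infdist (A *v y) D \<le> norm v"
proof -
  define F where "F = (\<lambda>x. ereal (1/2 * (infdist (A *v x) D)\<^sup>2) + delta C x)"
  have "\<exists>c>0. \<forall>y v. norm (y - x\<^sub>0) < c \<longrightarrow> v \<in> regular_subdiff F y \<longrightarrow>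
      c * infdist (A *v y) D \<le> norm v"
  proof (rule ccontr)
    assume neg: "\<not> ?thesis"
    have "\<exists>y v. norm (y - x\<^sub>0) < inverse (real (Suc k)) \<and> v \<in> regular_subdiff F y \<and>
        norm v < inverse (real (Suc k)) * infdist (A *v y) D" for k
      using neg by (meson inverse_positive_iff_positive not_le of_nat_0_less_iff zero_less_Suc)
    then obtain y v where y: "\<And>k. norm (y k - x\<^sub>0) < inverse (real (Suc k))"
      and v: "\<And>k. v k \<in> regular_subdiff F (y k)"
      and small: "\<And>k. norm (v k) < inverse (real (Suc k)) * infdist (A *v y k) D"
      by metis
    have "\<exists>q\<in>D. infdist (A *v y k) D = dist (A *v y k) q" for k
      using infdist_attains_inf[OF D, of "A *v y k"] x0(2) by blast
    then obtain p where p: "\<And>k. p k \<in> D" "\<And>k. infdist (A *v y k) D = dist (A *v y k) (p k)"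
      by metis
    define d where "d k = infdist (A *v y k) D" for k
    have d: "d k > 0" for k
    proof -
      have "0 < inverse (real (Suc k)) * d k"
        using le_less_trans[OF norm_ge_zero small[of k]] by (simp add: d_def)
      then show ?thesis
        by (simp add: zero_less_mult_iff)
    qed
    have "(\<lambda>k. y k - x\<^sub>0) \<longlonglongrightarrow> 0"
      by (rule Lim_null_comparison[OF _ LIMSEQ_inverse_real_of_nat])
        (intro always_eventually allI less_imp_le y)
    then have y_lim: "y \<longlonglongrightarrow> x\<^sub>0"
      by (simp add: LIM_zero_iff)
    have Ay_lim: "(\<lambda>k. A *v y k) \<longlonglongrightarrow> A *v x\<^sub>0"
      using y_lim by (intro bounded_linear.tendsto[OF matrix_vector_mul_bounded_linear])
    have d_lim: "d \<longlonglongrightarrow> 0"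
      using tendsto_infdist[OF Ay_lim, of D] x0(2) by (simp add: d_def[abs_def])
    have "(\<lambda>k. A *v y k - p k) \<longlonglongrightarrow> 0"
      by (rule Lim_null_comparison[OF _ d_lim]) (simp add: d_def p(2) dist_norm)
    from tendsto_diff[OF Ay_lim this] have p_lim: "p \<longlonglongrightarrow> A *v x\<^sub>0"
      by simp
    define w where "w k = inverse (d k) *\<^sub>R (A *v y k - p k)" for k
    define u where "u k = inverse (d k) *\<^sub>R (v k - transpose A *v (A *v y k - p k))" for k
    have w_normal: "w k \<in> regular_subdiff (delta D) (p k)" for k
      unfolding w_def using d[of k] p
      by (intro regular_normal_scale regular_normal_of_nearest_point) auto
    have u_normal: "u k \<in> regular_subdiff (delta C) (y k)" for k
      unfolding u_def using d[of k] p v[of k]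
      by (intro regular_normal_scale regular_normal_of_dist_sq_subgradient) (auto simp: F_def)
    have norm_w: "norm (w k) = 1" for k
      using d[of k] p(2)[of k] by (simp add: w_def d_def dist_norm)
    obtain l r where r: "strict_mono r" and w_lim: "(w \<circ> r) \<longlonglongrightarrow> l"
      using bounded_imp_convergent_subsequence[of w] norm_w
      by (metis bounded_iff image_iff order_refl)
    have "norm l = 1"
      using tendsto_norm[OF w_lim] norm_w by (simp add: LIMSEQ_const_iff)
    have "norm (inverse (d k) *\<^sub>R v k) \<le> inverse (real (Suc k))" for k
      using small[of k] d[of k] by (simp add: d_def field_simps)
    then have "(\<lambda>k. inverse (d k) *\<^sub>R v k) \<longlonglongrightarrow> 0"
      by (intro Lim_null_comparison[OF _ LIMSEQ_inverse_real_of_nat]) auto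
    then have rem_lim: "(\<lambda>k. inverse (d (r k)) *\<^sub>R v (r k)) \<longlonglongrightarrow> 0"
      using LIMSEQ_subseq_LIMSEQ[OF _ r] by (fastforce simp: o_def)
    have "(\<lambda>k. transpose A *v w (r k)) \<longlonglongrightarrow> transpose A *v l"
      using w_lim by (intro bounded_linear.tendsto[OF matrix_vector_mul_bounded_linear])
        (simp add: o_def)
    moreover have "u k = inverse (d k) *\<^sub>R v k - transpose A *v w k" for k
      unfolding u_def w_def matrix_vector_mult_scaleR scaleR_diff_right[of _ "v k"] ..
    ultimately have u_lim: "(u \<circ> r) \<longlonglongrightarrow> - (transpose A *v l)"
      using tendsto_diff[OF rem_lim, of "\<lambda>k. transpose A *v w (r k)"]
      by (simp add: o_def del: transpose_matrix_vector)
    have "l \<in> normal_cone D (A *v x\<^sub>0)"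
      using w_normal by (intro normal_cone_limit[OF _ LIMSEQ_subseq_LIMSEQ[OF p_lim r] w_lim x0(2)])
        simp
    moreover have "- (transpose A *v l) \<in> normal_cone C x\<^sub>0"
      using u_normal by (intro normal_cone_limit[OF _ LIMSEQ_subseq_LIMSEQ[OF y_lim r] u_lim x0(1)])
        simp
    ultimately have "l = 0"
      using reg unfolding linearly_regular_def by (metis add.right_inverse)
    with \<open>norm l = 1\<close> show False
      by simp
  qed
  then show ?thesis
    using that unfolding F_def by blast
qed

theorem theorem5:
  fixes A :: "real^'n^'m" and C :: "(real^'n) set" and D :: "(real^'m) set"
    and x\<^sub>0 :: "real^'n"
  assumes "closed C" and "C \<noteq> {}"
    and "closed D" and "D \<noteq> {}"
    and "x\<^sub>0 \<in> C \<inter> {x. A *v x \<in> D}"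
    and "linearly_regular A C D x\<^sub>0"
  shows "KL_exponent (\<lambda>x. ereal (1/2 * (infdist (A *v x) D)\<^sup>2) + delta C x) x\<^sub>0 (1/2)"
proof -
  define g where "g = (\<lambda>x. 1/2 * (infdist (A *v x) D)\<^sup>2)"
  define F where "F = (\<lambda>x. ereal (g x) + delta C x)"
  have x0: "x\<^sub>0 \<in> C" "A *v x\<^sub>0 \<in> D"
    using assms(5) by auto
  have g_nonneg: "g x \<ge> 0" for x
    by (simp add: g_def)
  have F_x0: "F x\<^sub>0 = 0"
    using x0 by (simp add: F_def g_def delta_def)
  have dist_cont: "continuous_on UNIV (\<lambda>x. infdist (A *v x) D)"
    by (intro continuous_intros matrix_vector_mul_bounded_linear
        bounded_linear.continuous_on[OF matrix_vector_mul_bounded_linear])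
  then have g_cont: "continuous_on UNIV g"
    unfolding g_def by (intro continuous_intros)
  have "proper_fun F"
    using F_x0 unfolding proper_fun_def eff_dom_def
    by (auto simp: F_def delta_def intro!: exI[of _ x\<^sub>0] split: if_splits)
  moreover have "lsc F"
    unfolding F_def by (rule lsc_add_delta[OF g_cont assms(1)])
  moreover have "x\<^sub>0 \<in> dom_subdiff F"
  proof -
    have "0 \<in> regular_subdiff F x\<^sub>0"
      using x0 g_nonneg unfolding F_def regular_subdiff_add_delta_iff by (simp add: g_def)
    then have "0 \<in> subdiff F x\<^sub>0"
      using F_x0 unfolding subdiff_def eff_dom_def
      by (intro CollectI conjI exI[of _ "\<lambda>_. x\<^sub>0"] exI[of _ "\<lambda>_. 0"]) auto
    then show ?thesis
      by (auto simp: dom_subdiff_def)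
  qed
  moreover obtain c where c: "c > 0"
    and bound: "\<And>y v. norm (y - x\<^sub>0) < c \<Longrightarrow> v \<in> regular_subdiff F y \<Longrightarrow>
      c * infdist (A *v y) D \<le> norm v"
    using regular_subgradient_lower_bound[OF assms(3) x0 assms(6)] unfolding F_def g_def by blast
  \<comment> \<open>Both sides are continuous along a sequence defining a limiting subgradient, and the condition
    on the radius, being strict, holds at all late points of that sequence.\<close>
  have lim_bound: "c * infdist (A *v y) D \<le> norm v"
    if y: "norm (y - x\<^sub>0) < c" and v: "v \<in> subdiff F y" for y v
  proof -
    obtain xs vs where xs: "xs \<longlonglongrightarrow> y" and vs: "vs \<longlonglongrightarrow> v"
      and sub: "\<And>t. vs t \<in> regular_subdiff F (xs t)"
      using v by (auto simp: subdiff_def)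
    have "(\<lambda>t. norm (xs t - x\<^sub>0)) \<longlonglongrightarrow> norm (y - x\<^sub>0)"
      by (intro tendsto_intros xs)
    then have "\<forall>\<^sub>F t in sequentially. norm (xs t - x\<^sub>0) < c"
      using y by (rule order_tendstoD(2))
    then have ev: "\<forall>\<^sub>F t in sequentially. c * infdist (A *v xs t) D \<le> norm (vs t)"
      by (rule eventually_mono) (use bound sub in blast)
    have "(\<lambda>t. infdist (A *v xs t) D) \<longlonglongrightarrow> infdist (A *v y) D"
      by (intro tendsto_infdist bounded_linear.tendsto[OF matrix_vector_mul_bounded_linear] xs)
    then have "(\<lambda>t. c * infdist (A *v xs t) D) \<longlonglongrightarrow> c * infdist (A *v y) D"
      by (rule tendsto_mult_left)
    then show ?thesis
      using ev by (intro tendsto_le[OF _ tendsto_norm[OF vs]]) auto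
  qed
  have "ereal (c * real_of_ereal (F y - F x\<^sub>0) powr (1/2)) \<le> ext_dist 0 (subdiff F y)"
    if y: "norm (y - x\<^sub>0) \<le> c / 2" and fin: "F y - F x\<^sub>0 < \<infinity>" for y
  proof -
    have "F y = ereal (g y)"
      using fin F_x0 by (auto simp: F_def delta_def split: if_splits)
    then have "real_of_ereal (F y - F x\<^sub>0) powr (1/2) = sqrt (g y)"
      using F_x0 g_nonneg[of y] by (simp add: powr_half_sqrt)
    also have "\<dots> \<le> infdist (A *v y) D"
      by (rule real_le_lsqrt) (auto simp: g_def infdist_nonneg)
    finally have le: "c * real_of_ereal (F y - F x\<^sub>0) powr (1/2) \<le> c * infdist (A *v y) D"
      using c by simp
    show ?thesis
      unfolding ext_dist_def
    proof (rule INF_greatest)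
      fix v assume "v \<in> subdiff F y"
      then have "c * infdist (A *v y) D \<le> norm v"
        using y c by (intro lim_bound) auto
      with le show "ereal (c * real_of_ereal (F y - F x\<^sub>0) powr (1/2)) \<le> ereal (dist 0 v)"
        by simp
    qed
  qed
  then have "\<exists>c>0. \<exists>\<epsilon>>0. \<exists>s::ereal. 0 < s \<and>
      (\<forall>y. norm (y - x\<^sub>0) \<le> \<epsilon> \<and> 0 < F y - F x\<^sub>0 \<and> F y - F x\<^sub>0 < s \<longrightarrow>
        ereal (c * real_of_ereal (F y - F x\<^sub>0) powr (1/2)) \<le> ext_dist 0 (subdiff F y))"
    using c by (intro exI[of _ c] conjI exI[of _ "c / 2"] exI[of _ \<infinity>]) auto
  ultimately have "KL_exponent F x\<^sub>0 (1/2)"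
    by (simp add: KL_exponent_def)
  then show ?thesis
    by (simp add: F_def g_def)
qed

end
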